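(* Let $H>0$ and $r\in(1,2)$, and let $r^*=r/(r-1)$. Let $\varphi_r$ be the positive solution $$\varphi_r(x)=\frac{2H}{(2-r)\pi_r}\,\sin_r\!\left(\frac{\pi_r}{2H}x\right)\cos_r^{r-1}\!\left(\frac{\pi_r}{2H}x\right),\qquad 0\le x\le H,$$ of the nonlocal boundary value problem $$\varphi'-(\varphi')^2+\varphi\varphi''+\frac{2}{H}\int_0^H(\varphi'(t))^2\,dt=0 \ \text{ on } (0,H),\qquad \varphi(0)=\varphi(H)=0 .$$ Then $\varphi_r$ has one and only one extremum in $(0,H)$, namely $$\varphi_r(x_r)=\frac{2H}{(2-r)\pi_r}\,\frac{1}{r^{1/r}}\,\frac{1}{(r^* )^{1/r^*}},$$ which is the maximum, attained at $$x_r=\frac{2H}{\pi_r}\sin_r^{-1}\!\left(\frac{1}{r^{1/r}}\right).$$ Moreover, $x_r<H/2$.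
   Context: For $r\in(1,\infty)$ define $\sin_r^{-1}x:=\int_0^x(1-t^r)^{-1/r}\,dt$ for $0\le x\le 1$ and $\pi_r:=2\sin_r^{-1}1$. The function $\sin_r:[0,\pi_r/2]\to[0,1]$ is the (increasing) inverse function of $\sin_r^{-1}$, and $\cos_r x:=\frac{d}{dx}\sin_r x$, extended continuously to $[0,\pi_r/2]$; one has $\cos_r^r x+\sin_r^r x=1$ there. Powers are written $\cos_r^{a}x=(\cos_r x)^a$. It is known from earlier work (Kobayashi and Takeuchi) that the positive solutions (i.e. positive on $(0,H)$) of the nonlocal boundary value problem above are exactly the functions $\varphi_r$ given by the displayed formula, with free parameter $r\in(1,2)$. *)

theory Defs
  imports "HOL-Analysis.Analysis"
begin

text \<open>
  Generalised trigonometric functions with parameter \<open>r \<in> (1,\<infinity>)\<close>. For \<open>x = 1\<close> the integrand below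
  is singular at the right endpoint; the Henstock--Kurzweil integral coincides there with the
  (convergent) improper integral, so no separate limit is needed.
\<close>

definition arcsin_r :: "real \<Rightarrow> real \<Rightarrow> real" where
  "arcsin_r r x = integral {0..x} (\<lambda>t. (1 - t powr r) powr (- 1 / r))"

definition pi_r :: "real \<Rightarrow> real" where
  "pi_r r = 2 * arcsin_r r 1"

text \<open>Meaningful on \<open>[0, pi_r r / 2]\<close> only, as is \<open>cos_r\<close>; elsewhere the values are unspecified.\<close>

definition sin_r :: "real \<Rightarrow> real \<Rightarrow> real" where
  "sin_r r = the_inv_into {0..1} (arcsin_r r)"

text \<open>The derivative of \<open>sin_r\<close> on the open interval, extended by its limits to the endpoints.\<close>

definition cos_r :: "real \<Rightarrow> real \<Rightarrow> real" where
  "cos_r r x =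
     (if x \<in> {0<..<pi_r r / 2} then deriv (sin_r r) x
      else Lim (at x within {0<..<pi_r r / 2}) (deriv (sin_r r)))"

definition phi :: "real \<Rightarrow> real \<Rightarrow> real \<Rightarrow> real" where
  "phi H r x =
     2 * H / ((2 - r) * pi_r r)
       * sin_r r (pi_r r / (2 * H) * x) * cos_r r (pi_r r / (2 * H) * x) powr (r - 1)"

text \<open>
  Classical positive solutions of the nonlocal boundary value problem. Continuity of the second
  derivative is not demanded separately: it follows from the equation and \<open>f > 0\<close>. The values of
  \<open>deriv f\<close> at \<open>0\<close> and \<open>H\<close> are irrelevant for the integral.
\<close>

definition positive_solution :: "real \<Rightarrow> (real \<Rightarrow> real) \<Rightarrow> bool" where
  "positive_solution H f \<longleftrightarrow>
     continuous_on {0..H} f \<and>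
     (\<forall>x\<in>{0<..<H}. f differentiable (at x) \<and> deriv f differentiable (at x)) \<and>
     (\<lambda>t. (deriv f t)\<^sup>2) integrable_on {0..H} \<and>
     (\<forall>x\<in>{0<..<H}.
        deriv f x - (deriv f x)\<^sup>2 + f x * deriv (deriv f) x
          + 2 / H * integral {0..H} (\<lambda>t. (deriv f t)\<^sup>2) = 0) \<and>
     f 0 = 0 \<and> f H = 0 \<and>
     (\<forall>x\<in>{0<..<H}. f x > 0)"

definition local_extremum_on :: "real set \<Rightarrow> (real \<Rightarrow> real) \<Rightarrow> real \<Rightarrow> bool" where
  "local_extremum_on S f x \<longleftrightarrow>
     (\<forall>\<^sub>F y in at x within S. f y \<le> f x) \<or> (\<forall>\<^sub>F y in at x within S. f y \<ge> f x)"

end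

theory Submission
  imports Defs
begin

text \<open>
  Put \<open>S = sin_r\<close>, \<open>C = cos_r = (1 - S\<^sup>r)\<^bsup>1/r\<^esup>\<close> and \<open>k = pi_r / (2H)\<close>. The exponent
  \<open>r - 1\<close> in \<open>phi\<close> is what makes calculus easy: from \<open>S' = C\<close> one gets
  \<open>(S C\<^bsup>r-1\<^esup>)' = 1 - r S\<^sup>r\<close>, so that \<open>phi' = (1 - r S\<^sup>r) / (2 - r)\<close>, a strictly decreasing
  function whose only zero is where \<open>S\<^sup>r = 1/r\<close>. This settles existence, uniqueness, place and
  value of the extremum.

  For the differential equation, \<open>phi phi''\<close> and \<open>phi' - phi'\<^sup>2\<close> are both quadratic polynomials in
  \<open>S\<^sup>r\<close> whose nonconstant parts cancel (\<open>phi_local_equation\<close>): their sum is the constant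
  \<open>(1 - r) / (2 - r)\<^sup>2\<close>. The nonlocal term then has no freedom left. Since
  \<open>(phi phi')' = phi'\<^sup>2 + phi phi''\<close>, integrating the local identity over \<open>[0,H]\<close>, where \<open>phi\<close> vanishes at both
  ends, gives \<open>-2 \<integral> phi'\<^sup>2 = H (1 - r) / (2 - r)\<^sup>2\<close>, which is exactly the balance required by the
  equation (\<open>has_integral_deriv_phi_squared\<close>).

  The inequality \<open>x\<^sub>r < H/2\<close> says that \<open>phi\<close> rises faster than it falls. In the variable
  \<open>s = S\<^sup>r\<close> the time spent near \<open>s\<close> is \<open>p s\<^bsup>p-1\<^esup> (1 - s)\<^bsup>-p\<^esup> ds\<close> with \<open>p = 1/r\<close>, and the peak is at
  \<open>s = p\<close>, the mean of this beta density. As \<open>p > 1/2\<close>, the density at \<open>p + d\<close> exceeds the one at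
  \<open>p - d\<close> (\<open>beta_density_skewed\<close>). Hence at equal times \<open>t\<close> before and after the peak, \<open>s\<close> is farther
  from \<open>p\<close> before than after (\<open>sin_r_powr_reflection_sum\<close>). Since the slope of \<open>phi\<close> is proportional to
  \<open>p - s\<close>, the profile at time \<open>t\<close> after the peak is higher than at time \<open>t\<close> before it, so
  reading backwards from the peak \<open>phi\<close> would become negative by the time the forward branch
  reaches its zero, if the rising branch lasted at least as long as the falling one
  (\<open>arcsin_r_peak_less_quarter\<close>). The comparison is made at equal times because the density inequality
  alone leaves the interval \<open>[0, 2p - 1]\<close> unmatched.
\<close>

section \<open>Generalised sine and cosine\<close>

lemma one_minus_powr_pos:
  fixes x r :: real
  assumes "1 < r" "0 \<le> x" "x < 1"
  shows "0 < 1 - x powr r"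
  using powr_less_mono2[of r x 1] assms by simp

text \<open>
  The singularity at \<open>1\<close> is no worse than that of \<open>(1 - t)\<^bsup>-1/r\<^esup>\<close>, because \<open>t\<^sup>r \<le> t\<close>; the latter
  has the continuous antiderivative \<open>-(1 - t)\<^sup>c / c\<close> with \<open>c = 1 - 1/r > 0\<close>.
\<close>
lemma arcsin_r_integrand_integrable:
  fixes r :: real
  assumes r: "1 < r"
  shows "(\<lambda>t. (1 - t powr r) powr (- 1 / r)) integrable_on {0..1}"
proof (rule measurable_bounded_by_integrable_imp_integrable)
  define c where "c = 1 - 1 / r"
  have c: "0 < c" using r by (simp add: c_def)
  have "((\<lambda>t. (1 - t) powr (- 1 / r)) has_integral
      (- ((1 - 1) powr c) / c) - (- ((1 - 0) powr c) / c)) {0..1::real}"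
  proof (rule fundamental_theorem_of_calculus_interior)
    show "continuous_on {0..1} (\<lambda>t::real. - ((1 - t) powr c) / c)"
      using c by (intro continuous_intros continuous_on_powr') auto
    show "((\<lambda>t. - ((1 - t) powr c) / c) has_vector_derivative (1 - t) powr (- 1 / r)) (at t)"
      if "t \<in> {0<..<1}" for t :: real
    proof -
      have e: "c - 1 = - 1 / r" by (simp add: c_def)
      show ?thesis
        unfolding has_real_derivative_iff_has_vector_derivative[symmetric]
        using that c e by (auto intro!: derivative_eq_intros)
    qed
  qed simp
  then show "(\<lambda>t. (1 - t) powr (- 1 / r)) integrable_on {0..1::real}"
    by (rule has_integral_integrable)
  show "norm ((1 - t powr r) powr (- 1 / r)) \<le> (1 - t) powr (- 1 / r)"
    if "t \<in> {0..1}" for t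
  proof (cases "t = 1")
    case False
    with that have t: "0 \<le> t" "t < 1" by auto
    have "t powr r \<le> t" using powr_mono'[of 1 r t] t r by simp
    then show ?thesis using t r by (simp add: powr_mono2')
  qed simp
  show "(\<lambda>t. (1 - t powr r) powr (- 1 / r)) \<in> borel_measurable (lebesgue_on {0..1})"
    by (intro measurable_restrict_space1 measurable_completion) simp
qed simp

text \<open>
  The function \<open>sin_r cos_r\<^bsup>r-1\<^esup>\<close> written in terms of \<open>sin_r\<close> alone, which makes its continuity up to
  the endpoints visible.
\<close>
definition profile :: "real \<Rightarrow> real \<Rightarrow> real" where
  "profile r y = sin_r r y * (1 - sin_r r y powr r) powr ((r - 1) / r)"

context
  fixes r :: real
  assumes r: "1 < r"
begin

lemma arcsin_r_0: "arcsin_r r 0 = 0"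
  by (simp add: arcsin_r_def)

lemma continuous_on_arcsin_r: "continuous_on {0..1} (arcsin_r r)"
  unfolding arcsin_r_def
  by (rule indefinite_integral_continuous_1[OF arcsin_r_integrand_integrable[OF r]])

lemma has_real_derivative_arcsin_r:
  assumes x: "0 < x" "x < 1"
  shows "(arcsin_r r has_real_derivative (1 - x powr r) powr (- 1 / r)) (at x)"
proof -
  have "isCont (\<lambda>t. (1 - t powr r) powr (- 1 / r)) x"
    using x one_minus_powr_pos[OF r, of x] by (intro continuous_intros) auto
  then have "((\<lambda>u. integral {0..u} (\<lambda>t. (1 - t powr r) powr (- 1 / r)))
      has_vector_derivative (1 - x powr r) powr (- 1 / r)) (at x within ({0..1} - {}))"
    using x by (intro integral_has_vector_derivative_continuous_at[OF arcsin_r_integrand_integrable[OF r]])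
      (auto intro: continuous_at_imp_continuous_at_within)
  moreover have "at x within {0..1} = at x"
    using x by (intro at_within_interior) (simp add: interior_atLeastAtMost_real)
  ultimately show ?thesis
    unfolding arcsin_r_def has_real_derivative_iff_has_vector_derivative by simp
qed

lemma arcsin_r_strict_mono:
  assumes "0 \<le> x" "x < y" "y \<le> 1"
  shows "arcsin_r r x < arcsin_r r y"
proof (rule DERIV_pos_imp_increasing_open[OF \<open>x < y\<close>])
  show "\<exists>d. DERIV (arcsin_r r) z :> d \<and> 0 < d" if z: "x < z" "z < y" for z
    using has_real_derivative_arcsin_r[of z] one_minus_powr_pos[OF r, of z] z assms
    by (intro exI[of _ "(1 - z powr r) powr (- 1 / r)"]) auto
  show "continuous_on {x..y} (arcsin_r r)"
    using assms by (intro continuous_on_subset[OF continuous_on_arcsin_r]) auto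
qed

lemma pi_r_pos: "0 < pi_r r"
  using arcsin_r_strict_mono[of 0 1] by (simp add: pi_r_def arcsin_r_0)

lemma inj_on_arcsin_r: "inj_on (arcsin_r r) {0..1}"
  by (rule linorder_inj_onI) (use arcsin_r_strict_mono in force)+

lemma sin_r_arcsin_r: "x \<in> {0..1} \<Longrightarrow> sin_r r (arcsin_r r x) = x"
  by (simp add: sin_r_def the_inv_into_f_f inj_on_arcsin_r)

lemma arcsin_r_image: "arcsin_r r ` {0..1} = {0..pi_r r / 2}"
proof
  show "arcsin_r r ` {0..1} \<subseteq> {0..pi_r r / 2}"
  proof clarify
    fix x :: real assume "x \<in> {0..1}"
    then show "arcsin_r r x \<in> {0..pi_r r / 2}"
      using arcsin_r_strict_mono[of 0 x] arcsin_r_strict_mono[of x 1]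
      by (cases "x = 0"; cases "x = 1") (auto simp: pi_r_def arcsin_r_0)
  qed
  show "{0..pi_r r / 2} \<subseteq> arcsin_r r ` {0..1}"
  proof
    fix y assume "y \<in> {0..pi_r r / 2}"
    then have "\<exists>x\<ge>0. x \<le> 1 \<and> arcsin_r r x = y"
      by (intro IVT' continuous_on_arcsin_r) (auto simp: pi_r_def arcsin_r_0)
    then show "y \<in> arcsin_r r ` {0..1}" by force
  qed
qed

lemma
  assumes "y \<in> {0..pi_r r / 2}"
  shows arcsin_r_sin_r: "arcsin_r r (sin_r r y) = y"
    and sin_r_range: "sin_r r y \<in> {0..1}"
proof -
  obtain x where x: "x \<in> {0..1}" "y = arcsin_r r x"
    using assms arcsin_r_image by blast
  then show "arcsin_r r (sin_r r y) = y" "sin_r r y \<in> {0..1}"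
    by (simp_all add: sin_r_arcsin_r)
qed

lemma sin_r_0: "sin_r r 0 = 0"
  using sin_r_arcsin_r[of 0] by (simp add: arcsin_r_0)

lemma sin_r_pi_half: "sin_r r (pi_r r / 2) = 1"
  using sin_r_arcsin_r[of 1] by (simp add: pi_r_def)

lemma continuous_on_sin_r: "continuous_on {0..pi_r r / 2} (sin_r r)"
  using continuous_on_inv[OF continuous_on_arcsin_r, of "sin_r r"] sin_r_arcsin_r
  by (simp add: arcsin_r_image)

lemma sin_r_strict_mono:
  assumes "0 \<le> y" "y < z" "z \<le> pi_r r / 2"
  shows "sin_r r y < sin_r r z"
proof (rule ccontr)
  assume "\<not> sin_r r y < sin_r r z"
  then have "arcsin_r r (sin_r r z) \<le> arcsin_r r (sin_r r y)"
    using arcsin_r_strict_mono[of "sin_r r z" "sin_r r y"]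
      sin_r_range[of y] sin_r_range[of z] assms
    by (cases "sin_r r z = sin_r r y") auto
  then show False using assms by (simp add: arcsin_r_sin_r)
qed

lemma sin_r_strict_range:
  assumes "0 < y" "y < pi_r r / 2"
  shows "0 < sin_r r y" "sin_r r y < 1"
  using sin_r_strict_mono[of 0 y] sin_r_strict_mono[of y "pi_r r / 2"] assms
  by (simp_all add: sin_r_0 sin_r_pi_half)

lemma has_real_derivative_sin_r:
  assumes y: "0 < y" "y < pi_r r / 2"
  shows "(sin_r r has_real_derivative (1 - sin_r r y powr r) powr (1 / r)) (at y)"
proof -
  let ?D = "(1 - sin_r r y powr r) powr (- 1 / r)"
  have pos: "0 < 1 - sin_r r y powr r"
    using sin_r_strict_range[OF y] one_minus_powr_pos[OF r] by simp
  have "DERIV (sin_r r) y :> inverse ?D"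
  proof (rule DERIV_inverse_function[OF _ _ y])
    show "DERIV (arcsin_r r) (sin_r r y) :> ?D"
      using sin_r_strict_range[OF y] by (rule has_real_derivative_arcsin_r)
    show "isCont (sin_r r) y"
      using continuous_on_interior[OF continuous_on_sin_r] y
      by (simp add: interior_atLeastAtMost_real)
  qed (use y pos arcsin_r_sin_r in auto)
  moreover have "inverse ?D = (1 - sin_r r y powr r) powr (1 / r)"
    by (simp add: powr_minus)
  ultimately show ?thesis by simp
qed

text \<open>
  At the right endpoint \<open>cos_r\<close> is defined as a limit, and its value there matters since it makes
  \<open>phi\<close> vanish at \<open>H\<close>. At \<open>0\<close> the cosine is multiplied by \<open>sin_r 0 = 0\<close> wherever it occurs,
  hence the half-open range.
\<close>
lemma cos_r_eq:
  assumes y: "0 < y" "y \<le> pi_r r / 2"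
  shows "cos_r r y = (1 - sin_r r y powr r) powr (1 / r)"
proof (cases "y = pi_r r / 2")
  case False
  with y show ?thesis
    using DERIV_imp_deriv[OF has_real_derivative_sin_r[of y]] by (simp add: cos_r_def)
next
  case True
  let ?I = "{0<..<pi_r r / 2}"
  have cont: "continuous_on {0..pi_r r / 2} (\<lambda>z. (1 - sin_r r z powr r) powr (1 / r))"
  proof (intro continuous_on_powr' continuous_intros continuous_on_sin_r ballI)
    fix z assume z: "z \<in> {0..pi_r r / 2}"
    then show "0 \<le> sin_r r z \<and> (sin_r r z = 0 \<longrightarrow> 0 < r)"
      using sin_r_range[OF z] r by auto
    show "0 \<le> 1 - sin_r r z powr r \<and> (1 - sin_r r z powr r = 0 \<longrightarrow> 0 < 1 / r)"
      using sin_r_range[OF z] r by (auto intro: powr_le1)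
  qed
  then have "((\<lambda>z. (1 - sin_r r z powr r) powr (1 / r))
      \<longlongrightarrow> (1 - sin_r r y powr r) powr (1 / r)) (at y within {0..pi_r r / 2})"
    using y by (auto simp: continuous_on)
  then have "((\<lambda>z. (1 - sin_r r z powr r) powr (1 / r))
      \<longlongrightarrow> (1 - sin_r r y powr r) powr (1 / r)) (at y within ?I)"
    by (rule tendsto_within_subset) auto
  then have "(deriv (sin_r r) \<longlongrightarrow> (1 - sin_r r y powr r) powr (1 / r)) (at y within ?I)"
  proof (rule Lim_transform_eventually)
    show "\<forall>\<^sub>F z in at y within ?I. (1 - sin_r r z powr r) powr (1 / r) = deriv (sin_r r) z"
      unfolding eventually_at_filter
      using DERIV_imp_deriv[OF has_real_derivative_sin_r] by auto
  qed
  moreover have "at y within ?I \<noteq> bot"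
    using pi_r_pos by (simp add: trivial_limit_within islimpt_greaterThanLessThan2 True)
  ultimately show ?thesis
    using tendsto_Lim[of "at y within ?I" "deriv (sin_r r)"]
    unfolding cos_r_def by (simp add: True)
qed

lemma sin_cos_r_eq_profile:
  assumes "0 \<le> y" "y \<le> pi_r r / 2"
  shows "sin_r r y * cos_r r y powr (r - 1) = profile r y"
proof (cases "y = 0")
  case True
  then show ?thesis by (simp add: profile_def sin_r_0)
next
  case False
  then show ?thesis
    using assms cos_r_eq[of y] by (simp add: profile_def powr_powr)
qed

lemma continuous_on_profile: "continuous_on {0..pi_r r / 2} (profile r)"
  unfolding profile_def[abs_def]
proof (intro continuous_on_powr' continuous_intros continuous_on_sin_r ballI)
  fix z assume z: "z \<in> {0..pi_r r / 2}"
  then show "0 \<le> sin_r r z \<and> (sin_r r z = 0 \<longrightarrow> 0 < r)"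
    using sin_r_range[OF z] r by auto
  show "0 \<le> 1 - sin_r r z powr r \<and> (1 - sin_r r z powr r = 0 \<longrightarrow> 0 < (r - 1) / r)"
    using sin_r_range[OF z] r by (auto intro: powr_le1)
qed

text \<open>
  With \<open>u = 1 - S\<^sup>r = C\<^sup>r\<close>, the powers of \<open>u\<close> in the derivative of \<open>C\<^bsup>r-1\<^esup>\<close> cancel, leaving
  \<open>-(r - 1) S\<^bsup>r-1\<^esup>\<close>; hence \<open>(S C\<^bsup>r-1\<^esup>)' = C\<^sup>r - (r - 1) S\<^sup>r = 1 - r S\<^sup>r\<close>.
\<close>
lemma has_real_derivative_profile:
  assumes y: "0 < y" "y < pi_r r / 2"
  shows "(profile r has_real_derivative 1 - r * sin_r r y powr r) (at y)"
proof -
  define s where "s = sin_r r y"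
  define u where "u = 1 - s powr r"
  have s: "0 < s" and u: "0 < u"
    using sin_r_strict_range[OF y] one_minus_powr_pos[OF r] by (simp_all add: s_def u_def)
  have ds: "(sin_r r has_real_derivative u powr (1 / r)) (at y)"
    using has_real_derivative_sin_r[OF y] by (simp add: s_def u_def)
  have du: "((\<lambda>y. 1 - sin_r r y powr r) has_real_derivative
      - (r * s powr (r - 1) * u powr (1 / r))) (at y)"
    using s by (auto intro!: derivative_eq_intros ds simp: s_def)
  have dp: "((\<lambda>y. (1 - sin_r r y powr r) powr ((r - 1) / r)) has_real_derivative
      ((r - 1) / r) * u powr ((r - 1) / r - 1) * - (r * s powr (r - 1) * u powr (1 / r))) (at y)"
    by (rule DERIV_chain2[OF _ du]) (use has_real_derivative_powr[OF u, of "(r - 1) / r"] in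
        \<open>simp add: u_def s_def\<close>)
  have e1: "u powr ((r - 1) / r - 1) * u powr (1 / r) = 1"
    using u r by (simp add: powr_add[symmetric] field_simps)
  have e2: "u powr (1 / r) * u powr ((r - 1) / r) = u"
    using u r by (simp add: powr_add[symmetric] field_simps)
  have e3: "s * s powr (r - 1) = s powr r"
    using s by (simp add: powr_mult_base)
  have "((r - 1) / r * A * - (r * B * C)) * s = - (r - 1) * (s * B) * (A * C)" for A B C
    using r by (simp add: field_simps)
  then have "((r - 1) / r * u powr ((r - 1) / r - 1) * - (r * s powr (r - 1) * u powr (1 / r))) * s
      = - (r - 1) * (s * s powr (r - 1)) * (u powr ((r - 1) / r - 1) * u powr (1 / r))" .
  also have "\<dots> = - (r - 1) * s powr r" by (simp only: e1 e3 mult_1_right)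
  finally have e4: "((r - 1) / r * u powr ((r - 1) / r - 1) * - (r * s powr (r - 1) * u powr (1 / r))) * s
      = - (r - 1) * s powr r" .
  have "(profile r has_real_derivative
      u powr (1 / r) * u powr ((r - 1) / r)
      + ((r - 1) / r * u powr ((r - 1) / r - 1) * - (r * s powr (r - 1) * u powr (1 / r))) * s) (at y)"
    unfolding profile_def[abs_def]
    using DERIV_mult[OF ds dp] by (simp add: s_def u_def)
  then show ?thesis
    unfolding e2 e4 by (simp add: u_def s_def algebra_simps)
qed

end

section \<open>The peak of the profile lies in the first half\<close>

text \<open>
  Since \<open>p - 1 = -q\<close>, the difference of the logarithms is an elementary function; it vanishes at \<open>d = 0\<close> and has derivative
  \<open>2pq (1/(q\<^sup>2 - d\<^sup>2) - 1/(p\<^sup>2 - d\<^sup>2))\<close>, which is positive as \<open>q < p\<close>.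
\<close>
lemma beta_density_skewed:
  fixes p q d :: real
  assumes "p + q = 1" "0 < q" "q < p" "0 < d" "d < q"
  shows "(p - d) powr (p - 1) * (q + d) powr - p < (p + d) powr (p - 1) * (q - d) powr - p"
proof -
  define g where "g e = q * ln (p - e) + p * ln (q + e) - q * ln (p + e) - p * ln (q - e)" for e
  have "g 0 < g d"
  proof (rule DERIV_pos_imp_increasing_open[OF \<open>0 < d\<close>])
    fix e assume e: "0 < e" "e < d"
    let ?g' = "- q / (p - e) + p / (q + e) - q / (p + e) + p / (q - e)"
    have *: "0 < p - e" "0 < q - e" "0 < p + e" "0 < q + e" using e assms by auto
    have "DERIV g e :> ?g'"
      unfolding g_def[abs_def] using *
      by (auto intro!: derivative_eq_intros)
    moreover have "- q / (p - e) - q / (p + e) = - 2 * p * q * (1 / ((p - e) * (p + e)))"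
      "p / (q + e) + p / (q - e) = 2 * p * q * (1 / ((q - e) * (q + e)))"
      using * by (simp_all add: field_simps)
    then have "?g' = 2 * p * q * (1 / ((q - e) * (q + e)) - 1 / ((p - e) * (p + e)))"
      by (simp add: right_diff_distrib)
    moreover have "1 / ((p - e) * (p + e)) < 1 / ((q - e) * (q + e))"
      using * assms e by (intro divide_strict_left_mono mult_strict_mono mult_pos_pos) auto
    ultimately show "\<exists>y. DERIV g e :> y \<and> 0 < y"
      using assms by (intro exI[of _ ?g']) simp
  next
    show "continuous_on {0..d} g"
      unfolding g_def[abs_def] using assms by (intro continuous_intros) auto
  qed
  then have "(p - 1) * ln (p - d) + - p * ln (q + d) < (p - 1) * ln (p + d) + - p * ln (q - d)"
  proof -
    have "p - 1 = - q" using assms by simp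
    then show ?thesis using \<open>g 0 < g d\<close> by (simp only: g_def) simp
  qed
  then have "exp ((p - 1) * ln (p - d) + - p * ln (q + d))
      < exp ((p - 1) * ln (p + d) + - p * ln (q - d))" by simp
  then show ?thesis
    using assms by (simp add: powr_def exp_add[symmetric])
qed

text \<open>
  The function \<open>s \<mapsto> arcsin_r (s\<^sup>p)\<close> is \<open>p\<close> times an antiderivative of the density
  \<open>s\<^bsup>p-1\<^esup> (1 - s)\<^bsup>-p\<^esup>\<close>, so the skewness of the density makes its symmetric second difference at
  \<open>p\<close> positive.
\<close>
lemma arcsin_r_powr_sum_increases:
  fixes r d :: real
  defines "p \<equiv> 1 / r"
  assumes "1 < r" "r < 2" "0 < d" "d < 1 - p"
  shows "2 * arcsin_r r (p powr p) < arcsin_r r ((p + d) powr p) + arcsin_r r ((p - d) powr p)"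
proof -
  have p: "0 < p" "p < 1" "1 - p < p" using assms by (auto simp: p_def field_simps)
  define Y where "Y s = arcsin_r r (s powr p)" for s
  have powr_r: "(s powr p) powr r = s" if "0 < s" for s
    using that assms(2) by (simp add: powr_powr p_def)
  have dY: "DERIV Y s :> p * (s powr (p - 1) * (1 - s) powr - p)" if s: "0 < s" "s < 1" for s
  proof -
    have "s powr p < 1" using powr_less_mono2[of p s 1] s p by simp
    then have "DERIV (arcsin_r r) (s powr p) :> (1 - (s powr p) powr r) powr (- 1 / r)"
      using s by (intro has_real_derivative_arcsin_r assms) auto
    then have "DERIV (arcsin_r r) (s powr p) :> (1 - s) powr - p"
      using s by (simp only: powr_r[OF s(1)]) (simp add: p_def)
    from DERIV_chain2[OF this has_real_derivative_powr[OF s(1)]] show ?thesis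
      unfolding Y_def[abs_def] by (simp add: mult_ac)
  qed
  have dsum: "DERIV (\<lambda>e. Y (p + e) + Y (p - e)) e :>
      p * ((p + e) powr (p - 1) * (1 - (p + e)) powr - p)
      - p * ((p - e) powr (p - 1) * (1 - (p - e)) powr - p)"
    if "0 \<le> e" "e \<le> d" for e
  proof -
    have i: "0 < p + e" "p + e < 1" "0 < p - e" "p - e < 1" using that assms(5) p by linarith+
    show ?thesis
      by (rule derivative_eq_intros DERIV_chain2[where f = Y and g = "\<lambda>e. p + e", OF dY[OF i(1,2)]]
            DERIV_chain2[where f = Y and g = "\<lambda>e. p - e", OF dY[OF i(3,4)]] refl)+ simp
  qed
  have "Y (p + 0) + Y (p - 0) < Y (p + d) + Y (p - d)"
  proof (rule DERIV_pos_imp_increasing_open[OF \<open>0 < d\<close>])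
    fix e assume e: "0 < e" "e < d"
    have "(p - e) powr (p - 1) * (1 - p + e) powr - p < (p + e) powr (p - 1) * (1 - p - e) powr - p"
      using e assms p by (intro beta_density_skewed) auto
    then have "p * ((p - e) powr (p - 1) * (1 - p + e) powr - p)
        < p * ((p + e) powr (p - 1) * (1 - p - e) powr - p)"
      using p by simp
    then show "\<exists>y. DERIV (\<lambda>e. Y (p + e) + Y (p - e)) e :> y \<and> 0 < y"
      using dsum[of e] e by (intro exI[of _ "p * ((p + e) powr (p - 1) * (1 - (p + e)) powr - p)
      - p * ((p - e) powr (p - 1) * (1 - (p - e)) powr - p)"]) (auto simp: algebra_simps)
  next
    show "continuous_on {0..d} (\<lambda>e. Y (p + e) + Y (p - e))"
      using dsum by (intro DERIV_continuous_on[OF DERIV_subset]) auto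
  qed
  then show ?thesis by (simp add: Y_def)
qed

text \<open>
  The previous lemma read for the inverse function: with \<open>p + d\<close> the value of \<open>sin_r\<^sup>r\<close> at time \<open>t\<close>
  after the peak, the value \<open>p - d\<close> is taken less than \<open>t\<close> before the peak, so at time \<open>t\<close> before the
  peak \<open>sin_r\<^sup>r\<close> is below \<open>p - d\<close>.
\<close>
lemma sin_r_powr_reflection_sum:
  fixes r t :: real
  defines "y0 \<equiv> arcsin_r r (1 / r powr (1 / r))"
  assumes "1 < r" "r < 2" "0 < t" "t \<le> y0" "y0 + t < pi_r r / 2"
  shows "sin_r r (y0 + t) powr r + sin_r r (y0 - t) powr r < 2 / r"
proof -
  define p where "p = 1 / r"
  have p: "0 < p" "p < 1" "1 - p < p" using assms by (auto simp: p_def field_simps)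
  have powr_r: "(s powr p) powr r = s" "(s powr r) powr p = s" if "0 \<le> s" for s
    using that assms(2) by (auto simp: powr_powr p_def)
  have a: "1 / r powr (1 / r) = p powr p" using assms by (simp add: p_def powr_divide)
  have pp: "p powr p \<in> {0..1}" using p by (auto intro: powr_le1)
  have y0: "y0 = arcsin_r r (p powr p)" by (simp add: y0_def a)
  have y0_r: "y0 \<in> {0..pi_r r / 2}"
    unfolding y0 arcsin_r_image[OF assms(2), symmetric] using pp by blast
  have sin_y0: "sin_r r y0 = p powr p" unfolding y0 by (rule sin_r_arcsin_r[OF assms(2) pp])
  define d where "d = sin_r r (y0 + t) powr r - p"
  have S: "0 < sin_r r (y0 + t)" "sin_r r (y0 + t) < 1"
    using sin_r_strict_range[OF assms(2), of "y0 + t"] assms by auto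
  have "p = sin_r r y0 powr r" using p by (simp add: sin_y0 powr_r)
  also have "\<dots> < sin_r r (y0 + t) powr r"
    using sin_r_strict_mono[OF assms(2), of y0 "y0 + t"] y0_r assms(2,4,6)
    by (intro powr_less_mono2) (auto simp: sin_y0)
  finally have d0: "0 < d" by (simp add: d_def)
  have d1: "d < 1 - p" using one_minus_powr_pos[OF assms(2), of "sin_r r (y0 + t)"] S by (simp add: d_def)
  have "arcsin_r r ((p + d) powr p) = y0 + t"
    using S assms y0_r by (simp add: d_def powr_r arcsin_r_sin_r)
  then have lt: "y0 - t < arcsin_r r ((p - d) powr p)"
    using arcsin_r_powr_sum_increases[of r d] assms d0 d1 y0 by (simp add: p_def)
  have m: "(p - d) powr p \<in> {0..1}" using p d0 d1 by (auto intro: powr_le1)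
  have "arcsin_r r ((p - d) powr p) \<in> {0..pi_r r / 2}"
    unfolding arcsin_r_image[OF assms(2), symmetric] using m by blast
  then have "sin_r r (y0 - t) < sin_r r (arcsin_r r ((p - d) powr p))"
    using lt assms by (intro sin_r_strict_mono) auto
  then have "sin_r r (y0 - t) < (p - d) powr p" by (simp add: sin_r_arcsin_r[OF assms(2) m])
  then have "sin_r r (y0 - t) powr r < ((p - d) powr p) powr r"
    using assms y0_r sin_r_range[OF assms(2), of "y0 - t"] by (intro powr_less_mono2) auto
  then have "sin_r r (y0 - t) powr r < p - d" using d1 p by (simp add: powr_r)
  then show ?thesis by (simp add: d_def p_def)
qed

text \<open>
  Let \<open>E t\<close> be the profile at time \<open>t\<close> after the peak minus the profile at time \<open>t\<close> before it. By the
  reflection lemma \<open>E\<close> increases strictly from \<open>E 0 = 0\<close>. If the rising branch were not shorter than the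
  falling one, of length \<open>T\<close>, then \<open>E T\<close> would be \<open>0\<close> minus a nonnegative value of the profile.
\<close>
lemma arcsin_r_peak_less_quarter:
  fixes r :: real
  assumes "1 < r" "r < 2"
  shows "arcsin_r r (1 / r powr (1 / r)) < pi_r r / 4"
proof (rule ccontr)
  define y0 where "y0 = arcsin_r r (1 / r powr (1 / r))"
  assume "\<not> arcsin_r r (1 / r powr (1 / r)) < pi_r r / 4"
  then have ge: "pi_r r / 4 \<le> y0" by (simp add: y0_def)
  have a: "0 < 1 / r powr (1 / r)" "1 / r powr (1 / r) < 1" using assms by (auto simp: gr_one_powr[of r "1 / r"])
  have "y0 < pi_r r / 2"
    using arcsin_r_strict_mono[OF assms(1), of "1 / r powr (1 / r)" 1] a by (simp add: y0_def pi_r_def)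
  define T where "T = pi_r r / 2 - y0"
  have T: "0 < T" "T \<le> y0" "y0 + T = pi_r r / 2" using ge \<open>y0 < _\<close> by (auto simp: T_def)
  let ?E = "\<lambda>t. profile r (y0 + t) - profile r (y0 - t)"
  have "?E 0 < ?E T"
  proof (rule DERIV_pos_imp_increasing_open[OF \<open>0 < T\<close>])
    fix t assume t: "0 < t" "t < T"
    have i: "0 < y0 + t" "y0 + t < pi_r r / 2" "0 < y0 - t" "y0 - t < pi_r r / 2"
      using t T by auto
    have "DERIV ?E t :> (1 - r * sin_r r (y0 + t) powr r) + (1 - r * sin_r r (y0 - t) powr r)"
      by (rule derivative_eq_intros refl
          DERIV_chain2[where f = "profile r" and g = "\<lambda>t. y0 + t",
            OF has_real_derivative_profile[OF assms(1) i(1,2)]]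
          DERIV_chain2[where f = "profile r" and g = "\<lambda>t. y0 - t",
            OF has_real_derivative_profile[OF assms(1) i(3,4)]])+ simp
    moreover have "sin_r r (y0 + t) powr r + sin_r r (y0 - t) powr r < 2 / r"
      unfolding y0_def by (rule sin_r_powr_reflection_sum) (use assms t T i in \<open>auto simp: y0_def\<close>)
    then have "r * (sin_r r (y0 + t) powr r + sin_r r (y0 - t) powr r) < 2"
      using assms by (simp add: field_simps)
    ultimately show "\<exists>y. DERIV ?E t :> y \<and> 0 < y"
      by (intro exI[of _ "(1 - r * sin_r r (y0 + t) powr r) + (1 - r * sin_r r (y0 - t) powr r)"])
        (simp add: algebra_simps)
  next
    show "continuous_on {0..T} ?E"
      by (intro continuous_intros continuous_on_compose2[OF continuous_on_profile[OF assms(1)]])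
        (use T in auto)
  qed
  moreover have "profile r (y0 + T) = 0"
    using assms by (simp add: T profile_def sin_r_pi_half)
  moreover have "0 \<le> profile r (y0 - T)"
    using sin_r_range[OF assms(1), of "y0 - T"] T assms by (auto simp: profile_def)
  ultimately show False by simp
qed

section \<open>The boundary value problem\<close>

definition peak :: "real \<Rightarrow> real \<Rightarrow> real" where
  "peak H r = 2 * H / pi_r r * arcsin_r r (1 / r powr (1 / r))"

text \<open>The derivative of \<open>phi\<close> on \<open>(0,H)\<close>, given by a formula that is continuous on all of \<open>[0,H]\<close>.\<close>
definition slope :: "real \<Rightarrow> real \<Rightarrow> real \<Rightarrow> real" where
  "slope H r x = (1 - r * sin_r r (pi_r r / (2 * H) * x) powr r) / (2 - r)"

context
  fixes H r k :: real
  assumes H: "0 < H" and r: "1 < r" "r < 2"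
  defines k: "k \<equiv> pi_r r / (2 * H)"
begin

lemma k_pos: "0 < k"
  using H pi_r_pos[OF r(1)] by (simp add: k)

lemma k_scale: "k * H = pi_r r / 2"
  using H by (simp add: k)

lemma k_mult_closed: "x \<in> {0..H} \<Longrightarrow> 0 \<le> k * x \<and> k * x \<le> pi_r r / 2"
  using k_pos by (simp add: k_scale[symmetric])

lemma k_image: "(\<lambda>x. k * x) ` {0..H} \<subseteq> {0..pi_r r / 2}"
  using k_mult_closed by auto

lemma k_mult_open: "0 < x \<Longrightarrow> x < H \<Longrightarrow> 0 < k * x \<and> k * x < pi_r r / 2"
  using k_pos by (simp add: k_scale[symmetric])

lemma slope_eq: "slope H r x = (1 - r * sin_r r (k * x) powr r) / (2 - r)"
  by (simp add: slope_def k)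

lemma phi_eq_profile:
  assumes "x \<in> {0..H}"
  shows "phi H r x = profile r (k * x) / ((2 - r) * k)"
proof -
  have "phi H r x = 2 * H / ((2 - r) * pi_r r) * profile r (k * x)"
    using sin_cos_r_eq_profile[OF r(1), of "k * x"] k_mult_closed[OF assms]
    by (simp add: phi_def k[symmetric] mult.assoc)
  moreover have "2 * H / ((2 - r) * pi_r r) = 1 / ((2 - r) * k)"
    using H by (simp add: k)
  ultimately show ?thesis by simp
qed

lemma continuous_on_phi: "continuous_on {0..H} (phi H r)"
proof -
  have "continuous_on {0..H} (\<lambda>x. profile r (k * x) / ((2 - r) * k))"
    using r k_pos k_image
    by (intro continuous_intros continuous_on_compose2[OF continuous_on_profile[OF r(1)]]) simp_all
  then show ?thesis
    by (rule continuous_on_eq) (simp add: phi_eq_profile)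
qed

lemma has_real_derivative_phi:
  assumes x: "0 < x" "x < H"
  shows "(phi H r has_real_derivative slope H r x) (at x)"
proof -
  have "((\<lambda>x. profile r (k * x)) has_real_derivative (1 - r * sin_r r (k * x) powr r) * k) (at x)"
    using k_mult_open[OF x] by (auto intro!: DERIV_chain2[OF has_real_derivative_profile[OF r(1)]]
        derivative_eq_intros)
  from DERIV_cdivide[OF this, of "(2 - r) * k"]
  have "((\<lambda>x. profile r (k * x) / ((2 - r) * k)) has_real_derivative slope H r x) (at x)"
    using k_pos by (simp add: slope_eq)
  then show ?thesis
    by (rule has_field_derivative_transform_within_open[where S = "{0<..<H}"])
      (use x in \<open>auto simp: phi_eq_profile\<close>)
qed

lemma deriv_phi: "0 < x \<Longrightarrow> x < H \<Longrightarrow> deriv (phi H r) x = slope H r x"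
  by (rule DERIV_imp_deriv[OF has_real_derivative_phi])

lemma has_real_derivative_slope:
  assumes x: "0 < x" "x < H"
  shows "(slope H r has_real_derivative
    - (r\<^sup>2 * k / (2 - r)) * sin_r r (k * x) powr (r - 1) * (1 - sin_r r (k * x) powr r) powr (1 / r)) (at x)"
proof -
  have "((\<lambda>x. sin_r r (k * x)) has_real_derivative (1 - sin_r r (k * x) powr r) powr (1 / r) * k) (at x)"
    using k_mult_open[OF x] by (auto intro!: DERIV_chain2[OF has_real_derivative_sin_r[OF r(1)]]
        derivative_eq_intros)
  from DERIV_chain2[OF has_real_derivative_powr[of _ r] this]
  have "((\<lambda>x. sin_r r (k * x) powr r) has_real_derivative
      r * sin_r r (k * x) powr (r - 1) * ((1 - sin_r r (k * x) powr r) powr (1 / r) * k)) (at x)"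
    using sin_r_strict_range[OF r(1)] k_mult_open[OF x] by blast
  from DERIV_cdivide[OF DERIV_diff[OF DERIV_const DERIV_cmult[OF this, of r]], of 1 "2 - r"]
  show ?thesis
    unfolding slope_eq[abs_def] by (simp add: power2_eq_square mult_ac)
qed

lemma has_real_derivative_deriv_phi:
  assumes x: "0 < x" "x < H"
  shows "(deriv (phi H r) has_real_derivative deriv (slope H r) x) (at x)"
proof (rule has_field_derivative_transform_within_open[where S = "{0<..<H}"])
  show "(slope H r has_real_derivative deriv (slope H r) x) (at x)"
    using has_real_derivative_slope[OF x] DERIV_imp_deriv by fastforce
qed (use x deriv_phi in auto)

text \<open>
  With \<open>s = S\<^sup>r\<close>, multiplied by \<open>(2 - r)\<^sup>2\<close>: \<open>phi phi''\<close> becomes \<open>-r\<^sup>2 s (1 - s)\<close>, because the fractional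
  powers of \<open>1 - s\<close> combine to the first power, and \<open>phi' - phi'\<^sup>2\<close> becomes
  \<open>(1 - r s)(1 - r + r s) = 1 - r + r\<^sup>2 s (1 - s)\<close>.
\<close>
lemma phi_local_equation:
  assumes x: "0 < x" "x < H"
  shows "slope H r x - (slope H r x)\<^sup>2 + phi H r x * deriv (slope H r) x = (1 - r) / (2 - r)\<^sup>2"
proof -
  define s where "s = sin_r r (k * x)"
  define u where "u = 1 - s powr r"
  have "0 < s" "s < 1"
    using sin_r_strict_range[OF r(1)] k_mult_open[OF x] by (simp_all add: s_def)
  then have s: "0 < s" and u: "0 < u"
    using one_minus_powr_pos[OF r(1), of s] by (simp_all add: u_def)
  have "u powr ((r - 1) / r) * u powr (1 / r) = u"
    using u r by (simp add: powr_add[symmetric] field_simps)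
  moreover have "s * s powr (r - 1) = s powr r"
    using s by (simp add: powr_mult_base)
  ultimately have e: "(s * u powr ((r - 1) / r)) * (s powr (r - 1) * u powr (1 / r)) = s powr r * u"
    by (metis mult.assoc mult.left_commute)
  have "phi H r x = s * u powr ((r - 1) / r) / ((2 - r) * k)"
    using phi_eq_profile[of x] x r by (simp add: profile_def s_def u_def)
  moreover have "deriv (slope H r) x = - (r\<^sup>2 * k / (2 - r)) * (s powr (r - 1) * u powr (1 / r))"
    using DERIV_imp_deriv[OF has_real_derivative_slope[OF x]] by (simp add: s_def u_def mult.assoc)
  ultimately have "phi H r x * deriv (slope H r) x
      = - (r\<^sup>2 * k / ((2 - r) * ((2 - r) * k)))
        * ((s * u powr ((r - 1) / r)) * (s powr (r - 1) * u powr (1 / r)))"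
    by simp
  also have "\<dots> = - r\<^sup>2 * (1 - u) * u / (2 - r)\<^sup>2"
    unfolding e using k_pos r by (simp add: power2_eq_square u_def)
  finally have p: "phi H r x * deriv (slope H r) x = - r\<^sup>2 * (1 - u) * u / (2 - r)\<^sup>2" .
  have sl: "slope H r x = (1 - r * (1 - u)) * (2 - r) / (2 - r)\<^sup>2"
    "(slope H r x)\<^sup>2 = (1 - r * (1 - u))\<^sup>2 / (2 - r)\<^sup>2"
    using r by (simp_all add: slope_eq s_def[symmetric] u_def power_divide power2_eq_square)
  show ?thesis
    unfolding p sl(2) unfolding sl(1) diff_divide_distrib[symmetric] add_divide_distrib[symmetric]
    by (rule arg_cong[where f = "\<lambda>z. z / (2 - r)\<^sup>2"]) algebra
qed

lemma phi_ends: "phi H r 0 = 0" "phi H r H = 0"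
  using phi_eq_profile[of 0] phi_eq_profile[of H] H r sin_r_0[OF r(1)] sin_r_pi_half[OF r(1)]
  by (simp_all add: profile_def k_scale)

text \<open>
  By the local equation, \<open>2 phi'\<^sup>2 = (phi phi')' + phi' + c\<close> with \<open>c = (r - 1) / (2 - r)\<^sup>2\<close>, so \<open>phi'\<^sup>2\<close>
  has an antiderivative in closed form, in which only the term \<open>c x\<close> contributes at the ends.
\<close>
lemma has_integral_deriv_phi_squared:
  "((\<lambda>t. (deriv (phi H r) t)\<^sup>2) has_integral (r - 1) * H / (2 * (2 - r)\<^sup>2)) {0..H}"
proof -
  define c where "c = (r - 1) / (2 - r)\<^sup>2"
  define G where "G x = (phi H r x * slope H r x + phi H r x + c * x) / 2" for x
  have "((\<lambda>t. (slope H r t)\<^sup>2) has_integral G H - G 0) {0..H}"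
  proof (rule fundamental_theorem_of_calculus_interior)
    have "continuous_on {0..H} (\<lambda>x. sin_r r (k * x))"
      using k_image
      by (intro continuous_intros continuous_on_compose2[OF continuous_on_sin_r[OF r(1)]])
    then have "continuous_on {0..H} (slope H r)"
      unfolding slope_eq[abs_def] using r sin_r_range[OF r(1)] k_mult_closed
      by (intro continuous_intros continuous_on_powr') auto
    then show "continuous_on {0..H} G"
      unfolding G_def[abs_def] by (intro continuous_intros continuous_on_phi) auto
  next
    fix x assume "x \<in> {0<..<H}"
    then have x: "0 < x" "x < H" by auto
    have dsl: "(slope H r has_real_derivative deriv (slope H r) x) (at x)"
      using has_real_derivative_slope[OF x] DERIV_imp_deriv by fastforce
    have "(G has_real_derivative
        (slope H r x * slope H r x + deriv (slope H r) x * phi H r x + slope H r x + c) / 2) (at x)"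
      unfolding G_def[abs_def]
      by (auto intro!: derivative_eq_intros has_real_derivative_phi[OF x] dsl)
    moreover have c: "c = - ((1 - r) / (2 - r)\<^sup>2)"
      unfolding c_def by (metis minus_diff_eq minus_divide_left)
    have "(a * a + b * p + a + - e) / 2 = a\<^sup>2" if "a - a\<^sup>2 + p * b = e" for a b p e :: real
      using that[symmetric] by (simp add: power2_eq_square)
    from this[OF phi_local_equation[OF x]]
    have "(slope H r x * slope H r x + deriv (slope H r) x * phi H r x + slope H r x + c) / 2 = (slope H r x)\<^sup>2"
      unfolding c .
    ultimately show "(G has_vector_derivative (slope H r x)\<^sup>2) (at x)"
      unfolding has_real_derivative_iff_has_vector_derivative[symmetric] by simp
  qed (use H in simp)
  moreover have "G H - G 0 = (r - 1) * H / (2 * (2 - r)\<^sup>2)"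
    by (simp add: G_def c_def phi_ends mult.commute)
  ultimately have "((\<lambda>t. (slope H r t)\<^sup>2) has_integral (r - 1) * H / (2 * (2 - r)\<^sup>2)) {0..H}"
    by simp
  then show ?thesis
    by (rule has_integral_spike_finite[of "{0, H}", rotated 2]) (auto simp: deriv_phi)
qed

lemma positive_solution_phi: "positive_solution H (phi H r)"
  unfolding positive_solution_def
proof (intro conjI ballI)
  show "continuous_on {0..H} (phi H r)" by (rule continuous_on_phi)
  show "(\<lambda>t. (deriv (phi H r) t)\<^sup>2) integrable_on {0..H}"
    using has_integral_deriv_phi_squared by (rule has_integral_integrable)
  show "phi H r 0 = 0" "phi H r H = 0" by (rule phi_ends)+
  fix x assume "x \<in> {0<..<H}"
  then have x: "0 < x" "x < H" by auto
  show "phi H r differentiable at x" "deriv (phi H r) differentiable at x"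
    using has_real_derivative_phi[OF x] has_real_derivative_deriv_phi[OF x]
    by (auto simp: real_differentiable_def)
  have dd: "deriv (deriv (phi H r)) x = deriv (slope H r) x"
    by (rule DERIV_imp_deriv[OF has_real_derivative_deriv_phi[OF x]])
  have "2 / H * ((r - 1) * H / (2 * (2 - r)\<^sup>2)) = - ((1 - r) / (2 - r)\<^sup>2)"
    using H by (simp add: minus_divide_left[symmetric] diff_divide_distrib)
  then show "deriv (phi H r) x - (deriv (phi H r) x)\<^sup>2 + phi H r x * deriv (deriv (phi H r)) x
      + 2 / H * integral {0..H} (\<lambda>t. (deriv (phi H r) t)\<^sup>2) = 0"
    using phi_local_equation[OF x]
    by (simp only: dd deriv_phi[OF x] integral_unique[OF has_integral_deriv_phi_squared])
  have "0 < sin_r r (k * x)" "sin_r r (k * x) < 1"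
    using sin_r_strict_range[OF r(1)] k_mult_open[OF x] by simp_all
  then show "0 < phi H r x"
    using one_minus_powr_pos[OF r(1), of "sin_r r (k * x)"] phi_eq_profile[of x] x k_pos r
    by (simp add: profile_def)
qed

section \<open>The extremum\<close>

lemma k_peak: "k * peak H r = arcsin_r r (1 / r powr (1 / r))"
  using H pi_r_pos[OF r(1)] by (simp add: peak_def k)

lemma peak_height: "0 < 1 / r powr (1 / r)" "1 / r powr (1 / r) < 1"
  using r by (auto simp: gr_one_powr[of r "1 / r"])

lemma sin_r_k_peak: "sin_r r (k * peak H r) = 1 / r powr (1 / r)"
  unfolding k_peak using peak_height by (intro sin_r_arcsin_r r) auto

lemma sin_r_k_peak_powr: "sin_r r (k * peak H r) powr r = 1 / r"
  unfolding sin_r_k_peak using r by (simp add: powr_divide powr_powr)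

lemma peak_less_half: "peak H r < H / 2"
proof -
  have "k * peak H r < k * (H / 2)"
    unfolding k_peak using arcsin_r_peak_less_quarter[OF r] k_scale by simp
  then show ?thesis using k_pos by simp
qed

lemma peak_pos: "0 < peak H r"
  using arcsin_r_strict_mono[OF r(1), of 0 "1 / r powr (1 / r)"] peak_height H pi_r_pos[OF r(1)]
  by (simp add: peak_def arcsin_r_0[OF r(1)])

lemma slope_strict_antimono:
  assumes "0 \<le> x" "x < y" "y \<le> H"
  shows "slope H r y < slope H r x"
proof -
  have "sin_r r (k * x) < sin_r r (k * y)"
    using assms k_pos k_mult_closed[of y] by (intro sin_r_strict_mono r) auto
  then have "sin_r r (k * x) powr r < sin_r r (k * y) powr r"
    using sin_r_range[OF r(1), of "k * x"] k_mult_closed[of x] assms r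
    by (intro powr_less_mono2) auto
  then show ?thesis
    using r by (simp add: slope_eq divide_strict_right_mono)
qed

lemma slope_peak: "slope H r (peak H r) = 0"
  using r by (simp add: slope_eq sin_r_k_peak_powr)

lemma phi_le_peak:
  assumes "x \<in> {0..H}"
  shows "phi H r x \<le> phi H r (peak H r)"
proof (cases x "peak H r" rule: linorder_cases)
  case less
  have "phi H r x < phi H r (peak H r)"
  proof (rule DERIV_pos_imp_increasing_open[OF less])
    show "\<exists>d. DERIV (phi H r) z :> d \<and> 0 < d" if "x < z" "z < peak H r" for z
      using that assms peak_less_half H slope_strict_antimono[of z "peak H r"]
      by (intro exI[of _ "slope H r z"] conjI has_real_derivative_phi) (auto simp: slope_peak)
    show "continuous_on {x..peak H r} (phi H r)"
      using assms peak_less_half H by (intro continuous_on_subset[OF continuous_on_phi]) auto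
  qed
  then show ?thesis by simp
next
  case greater
  have "phi H r x < phi H r (peak H r)"
  proof (rule DERIV_neg_imp_decreasing_open[OF greater])
    show "\<exists>d. DERIV (phi H r) z :> d \<and> d < 0" if "peak H r < z" "z < x" for z
      using that assms peak_pos slope_strict_antimono[of "peak H r" z]
      by (intro exI[of _ "slope H r z"] conjI has_real_derivative_phi) (auto simp: slope_peak)
    show "continuous_on {peak H r..x} (phi H r)"
      using assms peak_pos by (intro continuous_on_subset[OF continuous_on_phi]) auto
  qed
  then show ?thesis by simp
qed simp

lemma local_extremum_iff_peak:
  assumes x: "0 < x" "x < H"
  shows "local_extremum_on {0..H} (phi H r) x \<longleftrightarrow> x = peak H r"
proof
  assume "x = peak H r"
  then show "local_extremum_on {0..H} (phi H r) x"
    unfolding local_extremum_on_def using phi_le_peak by (auto simp: eventually_at_filter)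
next
  assume ext: "local_extremum_on {0..H} (phi H r) x"
  have at: "at x within {0..H} = at x"
    using x by (intro at_within_interior) simp
  have zero: "slope H r x = 0"
    using ext unfolding local_extremum_on_def at
  proof
    assume "\<forall>\<^sub>F y in at x. phi H r y \<le> phi H r x"
    then obtain d where "0 < d" "\<forall>y. y \<noteq> x \<and> dist y x < d \<longrightarrow> phi H r y \<le> phi H r x"
      unfolding eventually_at by auto
    then have "\<forall>y. \<bar>x - y\<bar> < d \<longrightarrow> phi H r y \<le> phi H r x"
      by (metis abs_minus_commute dist_real_def order_refl)
    from DERIV_local_max[OF has_real_derivative_phi[OF x] \<open>0 < d\<close> this] show ?thesis .
  next
    assume "\<forall>\<^sub>F y in at x. phi H r x \<le> phi H r y"
    then obtain d where "0 < d" "\<forall>y. y \<noteq> x \<and> dist y x < d \<longrightarrow> phi H r x \<le> phi H r y"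
      unfolding eventually_at by auto
    then have "\<forall>y. \<bar>x - y\<bar> < d \<longrightarrow> phi H r x \<le> phi H r y"
      by (metis abs_minus_commute dist_real_def order_refl)
    from DERIV_local_min[OF has_real_derivative_phi[OF x] \<open>0 < d\<close> this] show ?thesis .
  qed
  show "x = peak H r"
    using slope_strict_antimono[of x "peak H r"] slope_strict_antimono[of "peak H r" x] zero slope_peak
      x peak_pos peak_less_half H by (cases x "peak H r" rule: linorder_cases) auto
qed

lemma phi_peak:
  assumes "rstar = r / (r - 1)"
  shows "phi H r (peak H r) = 2 * H / ((2 - r) * pi_r r) * (1 / r powr (1 / r)) * (1 / rstar powr (1 / rstar))"
proof -
  have "(1 - sin_r r (k * peak H r) powr r) powr ((r - 1) / r) = (1 / rstar) powr (1 / rstar)"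
    unfolding sin_r_k_peak_powr using r by (simp add: assms diff_divide_distrib)
  also have "\<dots> = 1 / rstar powr (1 / rstar)"
    using r by (simp add: assms powr_divide)
  finally have "profile r (k * peak H r) = (1 / r powr (1 / r)) * (1 / rstar powr (1 / rstar))"
    by (simp only: profile_def sin_r_k_peak)
  moreover have "phi H r (peak H r) = profile r (k * peak H r) / ((2 - r) * k)"
    using peak_pos peak_less_half H by (intro phi_eq_profile) auto
  moreover have "2 * H / ((2 - r) * pi_r r) = 1 / ((2 - r) * k)"
    using H by (simp add: k)
  ultimately show ?thesis by simp
qed

end

theorem theorem1p1:
  fixes H r rstar xr :: real
  assumes "H > 0" and "1 < r" and "r < 2"
    and "rstar = r / (r - 1)"
    and "xr = 2 * H / pi_r r * arcsin_r r (1 / r powr (1 / r))"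
  shows "positive_solution H (phi H r)
    \<and> {x \<in> {0<..<H}. local_extremum_on {0..H} (phi H r) x} = {xr}
    \<and> phi H r xr =
        2 * H / ((2 - r) * pi_r r) * (1 / r powr (1 / r)) * (1 / rstar powr (1 / rstar))
    \<and> (\<forall>x\<in>{0..H}. phi H r x \<le> phi H r xr)
    \<and> xr < H / 2"
proof -
  note H = assms(1) and r = assms(2,3)
  have xr: "xr = peak H r"
    by (simp add: assms(5) peak_def)
  have inside: "0 < xr" "xr < H"
    using peak_pos[OF H r] peak_less_half[OF H r] H by (auto simp: xr)
  then have "{x \<in> {0<..<H}. local_extremum_on {0..H} (phi H r) x} = {xr}"
    using local_extremum_iff_peak[OF H r] by (auto simp: xr)
  then show ?thesis
    using positive_solution_phi[OF H r] phi_peak[OF H r assms(4)] phi_le_peak[OF H r]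
      peak_less_half[OF H r] by (simp add: xr)
qed

end
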